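(* Let $\mathbb{K}$ be a field and $d\ge 1$ a natural number. Let $\emptyset\ne\Omega\subset\mathbb{K}^d$ be finite and let $n\in\mathbb{N}_0$ be such that the evaluation map $\mathcal{A}_n^\Omega\colon\Pi_n\to\mathbb{K}^\Omega$, $p\mapsto(p(x))_{x\in\Omega}$, is surjective. Then $$\Omega=\mathcal{V}(\mathcal{I}_{n+1}(\Omega)).$$
   Context: $\Pi=\mathbb{K}[X_1,\dots,X_d]$ is the polynomial ring in $d$ variables over $\mathbb{K}$; $\deg$ denotes total degree, i.e. $\deg(p)=\max\{k_1+\dots+k_d : p_k\neq 0\}$ for $0\ne p=\sum_k p_kX_1^{k_1}\cdots X_d^{k_d}$. For $n\in\mathbb{N}_0$, $\Pi_n=\{p\in\Pi\setminus\{0\}:\deg(p)\le n\}\cup\{0\}$. For $V\subset\mathbb{K}^d$, $\mathcal{I}(V)=\{p\in\Pi: p(x)=0\text{ for all }x\in V\}$ is the vanishing ideal and $\mathcal{I}_n(V)=\mathcal{I}(V)\cap\Pi_n$ is the vector space of polynomials of degree at most $n$ vanishing on $V$. For a set $P\subset\Pi$, $\mathcal{V}(P)=\{x\in\mathbb{K}^d: p(x)=0\text{ for all }p\in P\}$. *)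

theory Defs
  imports
    "HOL-Library.FuncSet"
    "HOL-Library.Poly_Mapping"
    "HOL-Analysis.Finite_Cartesian_Product"
begin

text \<open>
  The polynomial ring in \<open>d = CARD('n)\<close> variables over \<open>'a\<close>: a polynomial is the finitely
  supported map from exponent vectors to coefficients, with the convolution product of
  \<^theory>\<open>HOL-Library.Poly_Mapping\<close>. The dimension \<open>CARD('n)\<close> is automatically at least 1.
\<close>

type_synonym ('a, 'n) mpolynomial = "('n \<Rightarrow>\<^sub>0 nat) \<Rightarrow>\<^sub>0 'a"

definition monomial_degree :: "('n::finite \<Rightarrow>\<^sub>0 nat) \<Rightarrow> nat" where
  "monomial_degree k = (\<Sum>i\<in>UNIV. Poly_Mapping.lookup k i)"

text \<open>Only meaningful for nonzero polynomials (the maximum of the empty set is unspecified).\<close>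

definition total_degree :: "('a::zero, 'n::finite) mpolynomial \<Rightarrow> nat" where
  "total_degree p = Max (monomial_degree ` Poly_Mapping.keys p)"

definition polys_upto :: "nat \<Rightarrow> ('a::zero, 'n::finite) mpolynomial set" where
  "polys_upto n = {p. p \<noteq> 0 \<and> total_degree p \<le> n} \<union> {0}"

definition poly_eval :: "('a::comm_semiring_1, 'n::finite) mpolynomial \<Rightarrow> 'a ^ 'n \<Rightarrow> 'a" where
  "poly_eval p x = (\<Sum>k\<in>Poly_Mapping.keys p. Poly_Mapping.lookup p k * (\<Prod>i\<in>UNIV. (x $ i) ^ Poly_Mapping.lookup k i))"

definition vanishing_ideal ::
    "('a::comm_semiring_1 ^ 'n::finite) set \<Rightarrow> ('a, 'n) mpolynomial set" where
  "vanishing_ideal V = {p. \<forall>x\<in>V. poly_eval p x = 0}"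

definition vanishing_upto ::
    "nat \<Rightarrow> ('a::comm_semiring_1 ^ 'n::finite) set \<Rightarrow> ('a, 'n) mpolynomial set" where
  "vanishing_upto n V = vanishing_ideal V \<inter> polys_upto n"

definition zero_locus ::
    "('a::comm_semiring_1, 'n::finite) mpolynomial set \<Rightarrow> ('a ^ 'n) set" where
  "zero_locus P = {x. \<forall>p\<in>P. poly_eval p x = 0}"

text \<open>
  The space of all functions from \<open>\<Omega>\<close> to the field is represented by \<open>\<Omega> \<rightarrow>\<^sub>E UNIV\<close>, the functions that
  are \<open>undefined\<close> outside \<open>\<Omega>\<close>.
\<close>

definition evaluation_map ::
    "('a::comm_semiring_1 ^ 'n::finite) set \<Rightarrow> ('a, 'n) mpolynomial \<Rightarrow> 'a ^ 'n \<Rightarrow> 'a" where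
  "evaluation_map \<Omega> p = (\<lambda>x\<in>\<Omega>. poly_eval p x)"

end

theory Submission
  imports Defs
begin

text \<open>
  By surjectivity, each \<open>w \<in> \<Omega>\<close> has a fundamental polynomial \<open>L w\<close> of degree at most \<open>n\<close> that is
  1 at \<open>w\<close> and 0 at the other points of \<open>\<Omega>\<close>. Let \<open>y \<notin> \<Omega>\<close> be a common zero of the polynomials
  of degree at most \<open>n + 1\<close> vanishing on \<open>\<Omega>\<close>. All products \<open>(X\<^sub>i - w\<^sub>i) * L w\<close> are among these
  polynomials, so \<open>L w\<close> vanishes at \<open>y\<close> for every \<open>w\<close>. But so is \<open>(\<Sum>w\<in>\<Omega>. L w) - 1\<close>, which is \<open>-1\<close>
  at \<open>y\<close>.
\<close>

text \<open>Indices outside the support carry coefficient 0. This allows \<open>p\<close>,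
  \<open>q\<close> and \<open>p + q\<close> to be evaluated over one index set, although
  cancellation may shrink the support of the sum.\<close>

lemma poly_eval_superset:
  assumes "finite A" "Poly_Mapping.keys p \<subseteq> A"
  shows "poly_eval p x
    = (\<Sum>k\<in>A. Poly_Mapping.lookup p k * (\<Prod>i\<in>UNIV. (x $ i) ^ Poly_Mapping.lookup k i))"
  unfolding poly_eval_def
  by (rule sum.mono_neutral_left[OF assms]) (auto simp: in_keys_iff)

lemma poly_eval_single:
  "poly_eval (Poly_Mapping.single k c) x = c * (\<Prod>i\<in>UNIV. (x $ i) ^ Poly_Mapping.lookup k i)"
  by (subst poly_eval_superset[of "{k}"]) auto

lemma poly_eval_0 [simp]: "poly_eval 0 x = 0"
  by (simp add: poly_eval_def)

lemma poly_eval_add: "poly_eval (p + q) x = poly_eval p x + poly_eval q x"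
proof -
  let ?A = "Poly_Mapping.keys p \<union> Poly_Mapping.keys q"
  have "Poly_Mapping.keys (p + q) \<subseteq> ?A"
    by (rule Poly_Mapping.keys_add)
  then show ?thesis
    by (simp add: poly_eval_superset[of ?A] lookup_add distrib_right sum.distrib)
qed

lemma poly_eval_sum: "poly_eval (\<Sum>i\<in>I. f i) x = (\<Sum>i\<in>I. poly_eval (f i) x)"
  by (induction I rule: infinite_finite_induct) (auto simp: poly_eval_add)

lemma sum_single_keys:
  "(\<Sum>k\<in>Poly_Mapping.keys p. Poly_Mapping.single k (Poly_Mapping.lookup p k)) = p"
  by (rule poly_mapping_eqI) (simp add: lookup_sum lookup_single when_def in_keys_iff)

text \<open>Both sides are additive in each argument, so writing \<open>p\<close> and
  \<open>q\<close> as sums of monomials reduces the claim to two monomials, whose exponents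
  add.\<close>

lemma poly_eval_mult: "poly_eval (p * q) x = poly_eval p x * poly_eval q x"
proof -
  have monomial: "poly_eval (Poly_Mapping.single k b * Poly_Mapping.single l c) x
      = poly_eval (Poly_Mapping.single k b) x * poly_eval (Poly_Mapping.single l c) x" for k l b c
    by (simp add: mult_single poly_eval_single lookup_add power_add prod.distrib mult_ac)
  let ?s = "\<lambda>p k. Poly_Mapping.single k (Poly_Mapping.lookup p k)"
  have "poly_eval ((\<Sum>k\<in>Poly_Mapping.keys p. ?s p k) * (\<Sum>l\<in>Poly_Mapping.keys q. ?s q l)) x
      = poly_eval (\<Sum>k\<in>Poly_Mapping.keys p. ?s p k) x
        * poly_eval (\<Sum>l\<in>Poly_Mapping.keys q. ?s q l) x"
    by (simp only: sum_product poly_eval_sum monomial)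
  then show ?thesis
    by (simp only: sum_single_keys)
qed

text \<open>The zero polynomial has no keys, so the condition on keys covers it too, and later
  degree bounds avoid \<open>Max\<close> and its unspecified value on the empty set.\<close>

lemma mem_polys_upto_iff:
  "p \<in> polys_upto n \<longleftrightarrow> (\<forall>k\<in>Poly_Mapping.keys p. monomial_degree k \<le> n)"
  by (cases "p = 0") (auto simp: polys_upto_def total_degree_def)

lemma polys_upto_0: "0 \<in> polys_upto n"
  by (simp add: polys_upto_def)

lemma polys_upto_mono: "m \<le> n \<Longrightarrow> polys_upto m \<subseteq> polys_upto n"
  by (force simp: mem_polys_upto_iff)

lemma polys_upto_single: "monomial_degree k \<le> n \<Longrightarrow> Poly_Mapping.single k c \<in> polys_upto n"
  by (auto simp: mem_polys_upto_iff)

lemma polys_upto_add: "p \<in> polys_upto n \<Longrightarrow> q \<in> polys_upto n \<Longrightarrow> p + q \<in> polys_upto n"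
  using Poly_Mapping.keys_add[of p q] by (fastforce simp: mem_polys_upto_iff)

lemma polys_upto_sum: "(\<And>i. i \<in> I \<Longrightarrow> f i \<in> polys_upto n) \<Longrightarrow> (\<Sum>i\<in>I. f i) \<in> polys_upto n"
  by (induction I rule: infinite_finite_induct) (simp_all add: polys_upto_add polys_upto_0)

lemma monomial_degree_add: "monomial_degree (k + l) = monomial_degree k + monomial_degree l"
  by (simp add: monomial_degree_def lookup_add sum.distrib)

text \<open>Each key of the product is a sum of a key of \<open>p\<close> and a key of
  \<open>q\<close>, and \<open>monomial_degree\<close> is additive.\<close>

lemma polys_upto_mult: "p \<in> polys_upto m \<Longrightarrow> q \<in> polys_upto n \<Longrightarrow> p * q \<in> polys_upto (m + n)"
  using keys_mult[of p q] by (fastforce simp: mem_polys_upto_iff monomial_degree_add add_mono)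

lemma polys_upto_const: "Poly_Mapping.single 0 c \<in> polys_upto n"
  by (rule polys_upto_single) (simp add: monomial_degree_def)

lemma poly_eval_const: "poly_eval (Poly_Mapping.single 0 c) x = c"
  by (simp add: poly_eval_single)

text \<open>The polynomial \<open>X_i - a\<close>; the inner \<open>single\<close> is the exponent
  vector of \<open>X_i\<close>.\<close>

definition linear_factor :: "'n::finite \<Rightarrow> 'a::comm_ring_1 \<Rightarrow> ('a, 'n) mpolynomial" where
  "linear_factor i a
    = Poly_Mapping.single (Poly_Mapping.single i 1) 1 + Poly_Mapping.single 0 (- a)"

lemma linear_factor_in_polys_upto: "linear_factor i a \<in> polys_upto 1"
  unfolding linear_factor_def
  by (intro polys_upto_add polys_upto_single)
    (auto simp: monomial_degree_def lookup_single when_def)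

lemma poly_eval_linear_factor: "poly_eval (linear_factor i a) x = x $ i - a"
proof -
  have "(\<Prod>j\<in>UNIV. x $ j ^ Poly_Mapping.lookup (Poly_Mapping.single i 1) j)
      = (\<Prod>j\<in>UNIV. if j = i then x $ j else 1)"
    by (intro prod.cong) (auto simp: lookup_single when_def)
  then show ?thesis
    by (simp add: linear_factor_def poly_eval_add poly_eval_const poly_eval_single)
qed

theorem theorem3p3:
  fixes \<Omega> :: "('a::field ^ 'n::finite) set"
    and n :: nat
  assumes "\<Omega> \<noteq> {}"
    and "finite \<Omega>"
    and "evaluation_map \<Omega> ` polys_upto n = (\<Omega> \<rightarrow>\<^sub>E UNIV)"
  shows "\<Omega> = zero_locus (vanishing_upto (n + 1) \<Omega>)"
proof
  show "\<Omega> \<subseteq> zero_locus (vanishing_upto (n + 1) \<Omega>)"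
    by (auto simp: zero_locus_def vanishing_upto_def vanishing_ideal_def)
next
  \<comment> \<open>For \<open>w\<close> outside \<Omega> the prescribed values are all 0, so
    \<open>L\<close> can be chosen as a total function.\<close>
  have "\<exists>p\<in>polys_upto n. \<forall>x\<in>\<Omega>. poly_eval p x = (if x = w then 1 else 0)" for w
  proof -
    have "(\<lambda>x\<in>\<Omega>. if x = w then 1 else 0) \<in> evaluation_map \<Omega> ` polys_upto n"
      unfolding assms(3) by auto
    then obtain p where "p \<in> polys_upto n"
      and p: "evaluation_map \<Omega> p = (\<lambda>x\<in>\<Omega>. if x = w then 1 else 0)"
      by force
    moreover have "poly_eval p x = (if x = w then 1 else 0)" if "x \<in> \<Omega>" for x
      using fun_cong[OF p, of x] that by (simp add: evaluation_map_def)
    ultimately show ?thesis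
      by blast
  qed
  then obtain L where L: "\<And>w. L w \<in> polys_upto n"
    and L_eval: "\<And>w x. x \<in> \<Omega> \<Longrightarrow> poly_eval (L w) x = (if x = w then 1 else 0)"
    by metis
  show "zero_locus (vanishing_upto (n + 1) \<Omega>) \<subseteq> \<Omega>"
  proof (rule subsetI, rule ccontr)
    fix y
    assume "y \<in> zero_locus (vanishing_upto (n + 1) \<Omega>)" and "y \<notin> \<Omega>"
    then have zero: "poly_eval p y = 0"
      if "p \<in> polys_upto (n + 1)" "\<And>x. x \<in> \<Omega> \<Longrightarrow> poly_eval p x = 0" for p
      using that by (auto simp: zero_locus_def vanishing_upto_def vanishing_ideal_def)
    have L_zero: "poly_eval (L w) y = 0" if "w \<in> \<Omega>" for w
    proof -
      have "y \<noteq> w"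
        using that \<open>y \<notin> \<Omega>\<close> by blast
      then obtain i where i: "y $ i \<noteq> w $ i"
        by (auto simp: vec_eq_iff)
      \<comment> \<open>On \<Omega> the linear factor vanishes at \<open>w\<close> and
        \<open>L w\<close> at all other points. At \<open>y\<close> the linear factor is nonzero by
        the choice of \<open>i\<close>, which forces \<open>L w\<close> to vanish there.\<close>
      have "poly_eval (linear_factor i (w $ i) * L w) y = 0"
      proof (rule zero)
        show "linear_factor i (w $ i) * L w \<in> polys_upto (n + 1)"
          using polys_upto_mult[OF linear_factor_in_polys_upto L] by (simp add: add.commute)
      qed (simp add: poly_eval_mult poly_eval_linear_factor L_eval)
      with i show ?thesis
        by (simp add: poly_eval_mult poly_eval_linear_factor)
    qed
    \<comment> \<open>At each point of the finite set \<Omega> exactly one summand is 1 and the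
      others are 0, so the constant -1 cancels the sum.\<close>
    have "poly_eval ((\<Sum>w\<in>\<Omega>. L w) + Poly_Mapping.single 0 (- 1)) y = 0"
    proof (rule zero)
      have "(\<Sum>w\<in>\<Omega>. L w) + Poly_Mapping.single 0 (- 1) \<in> polys_upto n"
        by (intro polys_upto_add polys_upto_sum polys_upto_const L)
      then show "(\<Sum>w\<in>\<Omega>. L w) + Poly_Mapping.single 0 (- 1) \<in> polys_upto (n + 1)"
        using polys_upto_mono[of n "n + 1"] by auto
    qed (simp add: poly_eval_add poly_eval_sum poly_eval_const L_eval assms(2))
    then show False
      by (simp add: poly_eval_add poly_eval_sum poly_eval_const L_zero)
  qed
qed

end
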